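(* There is no Riemannian metric $m$ on $\mathbb{B}$ having as isometries both: (i) all regular Möbius transformations $q\mapsto\big((1-q\overline{a})^{-*}*(q-a)\big)u$, with $a\in\mathbb{B}$ and $u\in\mathbb{H}$, $|u|=1$; and (ii) all maps of the form $q=x+yI\mapsto x+yA(I)$ ($x,y\in\mathbb{R}$, $y\ge 0$, $I\in\mathbb{S}$), with $A\in O(3)$, the orthogonal group of $\mathbb{R}^3$.
   Context: $\mathbb{H}$ is the skew-field of quaternions, $\mathbb{B}=\{q\in\mathbb{H}:|q|<1\}$ is the open unit ball, and $\mathbb{S}=\{q\in\mathbb{H}:q^2=-1\}$ is the unit two-sphere in the space of imaginary quaternions, identified with $\mathbb{R}^3$, on which $O(3)$ acts. The $*$-product of power series in the quaternionic variable $q$ is $(\sum q^na_n)*(\sum q^nb_n)=\sum q^n\sum_{k=0}^na_kb_{n-k}$, and $f^{-*}$ is the inverse of $f$ with respect to $*$; in particular $(1-q\overline a)^{-*}=\sum_{n\ge0}q^n\overline a^n$ on $\mathbb{B}$. The regular Möbius transformations map $\mathbb{B}$ bijectively onto $\mathbb{B}$. *)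

theory Defs
  imports
    "HOL-Analysis.Analysis"
    "HOL-Computational_Algebra.Formal_Power_Series"
begin

section \<open>The skew-field of quaternions\<close>

text \<open>A quaternion is a pair of a real part and an imaginary part in \<open>\<real>\<^sup>3\<close>.  The three coordinates
  of the imaginary part are those with respect to the usual units \<open>i, j, k\<close>.\<close>

codatatype quat = Quat (qRe: real) (qIm: "real^3")

lemma quat_eq_iff: "p = q \<longleftrightarrow> qRe p = qRe q \<and> qIm p = qIm q"
  by (auto intro: quat.expand)

lemma quat_eqI: "qRe p = qRe q \<Longrightarrow> qIm p = qIm q \<Longrightarrow> p = q"
  by (simp add: quat_eq_iff)

instantiation quat :: ab_group_add
begin

primcorec zero_quat where "qRe 0 = 0" | "qIm 0 = 0"
primcorec plus_quat where "qRe (p + q) = qRe p + qRe q" | "qIm (p + q) = qIm p + qIm q"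
primcorec uminus_quat where "qRe (- p) = - qRe p" | "qIm (- p) = - qIm p"
primcorec minus_quat where "qRe (p - q) = qRe p - qRe q" | "qIm (p - q) = qIm p - qIm q"

instance
  by standard (simp_all add: quat_eq_iff)

end

instantiation quat :: real_vector
begin

primcorec scaleR_quat where
  "qRe (scaleR r q) = r * qRe q" | "qIm (scaleR r q) = scaleR r (qIm q)"

instance
  by standard (simp_all add: quat_eq_iff algebra_simps)

end

instantiation quat :: real_inner
begin

definition inner_quat_def: "inner p q = qRe p * qRe q + inner (qIm p) (qIm q)"
definition norm_quat_def: "norm (q::quat) = sqrt (inner q q)"
definition sgn_quat_def: "sgn (q::quat) = q /\<^sub>R norm q"
definition dist_quat_def: "dist p q = norm (p - q)" for p q :: quat
definition uniformity_quat_def [code del]: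
  "(uniformity :: (quat \<times> quat) filter) = (INF e\<in>{0 <..}. principal {(x, y). dist x y < e})"
definition open_quat_def [code del]:
  "open (U :: quat set) \<longleftrightarrow> (\<forall>x\<in>U. eventually (\<lambda>(x', y). x' = x \<longrightarrow> y \<in> U) uniformity)"

instance
proof
  fix p :: quat
  show "inner p p = 0 \<longleftrightarrow> p = 0"
    by (auto simp: inner_quat_def quat_eq_iff add_nonneg_eq_0_iff)
qed (auto simp: quat_eq_iff inner_quat_def norm_quat_def sgn_quat_def dist_quat_def
      uniformity_quat_def open_quat_def algebra_simps inner_commute inner_add_left)

end

instantiation quat :: euclidean_space
begin

definition Basis_quat_def: "Basis = insert (Quat 1 0) (Quat 0 ` Basis)"

instance
proof
  fix p :: quat
  show "(\<forall>u\<in>Basis. inner p u = 0) \<longleftrightarrow> p = 0"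
    using euclidean_all_zero_iff[of "qIm p"]
    by (auto simp: Basis_quat_def inner_quat_def quat_eq_iff)
qed (auto simp: Basis_quat_def inner_quat_def inner_Basis split: if_splits)

end

instantiation quat :: real_normed_div_algebra
begin

primcorec one_quat where "qRe 1 = 1" | "qIm 1 = 0"
primcorec times_quat where
  "qRe (p * q) = qRe p * qRe q - inner (qIm p) (qIm q)"
| "qIm (p * q) = qRe p *\<^sub>R qIm q + qRe q *\<^sub>R qIm p + cross3 (qIm p) (qIm q)"
definition inverse_quat_def: "inverse q = Quat (qRe q) (- qIm q) /\<^sub>R (norm q)\<^sup>2"
definition divide_quat_def: "divide p q = p * inverse q" for p q :: quat

instance
proof
  fix p q r :: quat and c :: real
  have norm2: "(norm x)\<^sup>2 = (qRe x)\<^sup>2 + (qIm x) \<bullet> (qIm x)" for x :: quat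
    by (simp add: norm_quat_def inner_quat_def power2_eq_square)
  show "p * q * r = p * (q * r)"
    by (simp add: quat_eq_iff cross3_simps forall_3)
  show "(p + q) * r = p * r + q * r" "p * (q + r) = p * q + p * r"
    by (simp_all add: quat_eq_iff cross3_simps forall_3)
  show "1 * p = p" "p * 1 = p"
    by (simp_all add: quat_eq_iff)
  show "(0::quat) \<noteq> 1"
    by (simp add: quat_eq_iff)
  show "c *\<^sub>R p * q = c *\<^sub>R (p * q)" "p * c *\<^sub>R q = c *\<^sub>R (p * q)"
    by (simp_all add: quat_eq_iff cross3_simps forall_3)
  have conj: "Quat (qRe p) (- qIm p) * p = (norm p)\<^sup>2 *\<^sub>R 1" "p * Quat (qRe p) (- qIm p) = (norm p)\<^sup>2 *\<^sub>R 1"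
    unfolding norm2 by (simp_all add: quat_eq_iff power2_eq_square)
  have sl: "c *\<^sub>R x * y = c *\<^sub>R (x * y)" "x * c *\<^sub>R y = c *\<^sub>R (x * y)" for c and x y :: quat
    by (simp_all add: quat_eq_iff cross3_simps forall_3)
  show "p \<noteq> 0 \<Longrightarrow> inverse p * p = 1" "p \<noteq> 0 \<Longrightarrow> p * inverse p = 1"
    by (simp_all add: inverse_quat_def sl conj)
  show "divide p q = p * inverse q"
    by (simp add: divide_quat_def)
  show "inverse (0::quat) = 0"
    by (simp add: inverse_quat_def)
  have "(norm (p * q))\<^sup>2 = (norm p * norm q)\<^sup>2"
    unfolding power_mult_distrib norm2
    by (simp add: cross3_simps power2_eq_square)
  then show "norm (p * q) = norm p * norm q"
    by (simp add: power2_eq_iff_nonneg)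
qed

end

definition qcnj :: "quat \<Rightarrow> quat"
  where "qcnj q = Quat (qRe q) (- qIm q)"

definition imag_units :: "quat set"
  where "imag_units = {I. I\<^sup>2 = -1}"

definition unit_ball :: "quat set"
  where "unit_ball = {q. norm q < 1}"


section \<open>Regular power series and regular Moebius transformations\<close>

text \<open>Coefficients stand to the right of the powers of the variable; library evaluation of formal
  power series puts them to the left.  The product and inverse of formal power series
  over a noncommutative ring are the \<open>*\<close>-product and the \<open>*\<close>-inverse.\<close>

definition qeval :: "quat fps \<Rightarrow> quat \<Rightarrow> quat"
  where "qeval f q = (\<Sum>n. q ^ n * fps_nth f n)"

definition regular_moebius :: "quat \<Rightarrow> quat \<Rightarrow> quat \<Rightarrow> quat"
  where "regular_moebius a u q =
    qeval (inverse (1 - fps_X * fps_const (qcnj a)) * (fps_X - fps_const a)) q * u"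

lemma star_inverse:
  fixes a :: quat
  shows "inverse (1 - fps_X * fps_const a) * (1 - fps_X * fps_const a) = 1"
    and "(1 - fps_X * fps_const a) * inverse (1 - fps_X * fps_const a) = 1"
    and "inverse (1 - fps_X * fps_const a) = Abs_fps (\<lambda>n. a ^ n)"
proof -
  let ?f = "1 - fps_X * fps_const a"
  have f0: "fps_nth ?f 0 \<noteq> 0"
    by simp
  show 1: "inverse ?f * ?f = 1"
    using f0 by (rule inverse_mult_eq_1)
  show "?f * inverse ?f = 1"
    using f0 by (rule inverse_mult_eq_1')
  have "fps_nth (?f * Abs_fps (\<lambda>n. a ^ n)) n = fps_nth 1 n" for n
    by (cases n) (simp_all add: left_diff_distrib mult.assoc)
  then have 2: "?f * Abs_fps (\<lambda>n. a ^ n) = 1"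
    by (rule fps_ext)
  have "inverse ?f = inverse ?f * (?f * Abs_fps (\<lambda>n. a ^ n))"
    by (simp only: 2 mult_1_right)
  also have "\<dots> = Abs_fps (\<lambda>n. a ^ n)"
    by (simp only: 1 mult_1_left flip: mult.assoc)
  finally show "inverse ?f = Abs_fps (\<lambda>n. a ^ n)" .
qed


section \<open>Action of the orthogonal group\<close>

text \<open>\<open>\<phi>\<close> is the map \<open>x + yI \<mapsto> x + yA(I)\<close>; every quaternion is of the form \<open>x + yI\<close>, so this
  determines \<open>\<phi>\<close> (and \<open>\<phi>\<close> exists since \<open>A\<close> is linear, see below).\<close>

definition orthogonal_slice_map :: "real^3^3 \<Rightarrow> (quat \<Rightarrow> quat) \<Rightarrow> bool"
  where "orthogonal_slice_map A \<phi> \<longleftrightarrow> orthogonal_matrix A \<and>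
    (\<forall>x y. \<forall>I\<in>imag_units. y \<ge> 0 \<longrightarrow>
      \<phi> (of_real x + y *\<^sub>R I) = of_real x + y *\<^sub>R Quat 0 (A *v qIm I))"

lemma imag_units_iff: "I \<in> imag_units \<longleftrightarrow> qRe I = 0 \<and> norm (qIm I) = 1"
proof
  assume "I \<in> imag_units"
  then have eq: "qRe I * qRe I - qIm I \<bullet> qIm I = -1" "(2 * qRe I) *\<^sub>R qIm I = 0"
    by (simp_all add: imag_units_def power2_eq_square quat_eq_iff scaleR_2 flip: scaleR_scaleR)
  have "qIm I \<noteq> 0"
  proof
    assume "qIm I = 0"
    with eq(1) have "qRe I * qRe I = -1"
      by simp
    then show False
      by (metis neg_0_le_iff_le not_one_le_zero zero_le_square)
  qed
  with eq(2) have "qRe I = 0"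
    by simp
  with eq(1) show "qRe I = 0 \<and> norm (qIm I) = 1"
    by (simp add: norm_eq_1)
next
  assume "qRe I = 0 \<and> norm (qIm I) = 1"
  then show "I \<in> imag_units"
    by (simp add: imag_units_def power2_eq_square quat_eq_iff norm_eq_1)
qed

lemma of_real_quat: "of_real x = Quat x 0"
  by (simp add: of_real_def quat_eq_iff)

lemma orthogonal_slice_map_iff:
  "orthogonal_slice_map A \<phi> \<longleftrightarrow>
    orthogonal_matrix A \<and> \<phi> = (\<lambda>q. Quat (qRe q) (A *v qIm q))"
proof -
  have "\<phi> q = Quat (qRe q) (A *v qIm q)"
    if \<phi>: "\<And>x y I. I \<in> imag_units \<Longrightarrow> y \<ge> 0 \<Longrightarrow>
      \<phi> (of_real x + y *\<^sub>R I) = of_real x + y *\<^sub>R Quat 0 (A *v qIm I)" for q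
  proof -
    obtain e :: "real^3" where e: "norm e = 1" "qIm q = norm (qIm q) *\<^sub>R e"
    proof (cases "qIm q = 0")
      case True
      then show ?thesis
        using that[of "axis 1 1"] by simp
    next
      case False
      then show ?thesis
        using that[of "qIm q /\<^sub>R norm (qIm q)"] by simp
    qed
    define y where "y = norm (qIm q)"
    have e2: "qIm q = y *\<^sub>R e"
      using e(2) by (simp add: y_def)
    have q: "q = of_real (qRe q) + y *\<^sub>R Quat 0 e"
      by (simp add: of_real_quat quat_eq_iff e2)
    have "\<phi> (of_real (qRe q) + y *\<^sub>R Quat 0 e) = of_real (qRe q) + y *\<^sub>R Quat 0 (A *v e)"
      using \<phi>[of "Quat 0 e" y "qRe q"] e(1) by (simp add: imag_units_iff y_def)
    then have "\<phi> q = of_real (qRe q) + y *\<^sub>R Quat 0 (A *v e)"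
      using q by simp
    then show ?thesis
      by (simp add: of_real_quat quat_eq_iff e2 matrix_vector_mult_scaleR)
  qed
  moreover have "Quat (qRe (of_real x + y *\<^sub>R I)) (A *v qIm (of_real x + y *\<^sub>R I)) =
      of_real x + y *\<^sub>R Quat 0 (A *v qIm I)" if "I \<in> imag_units" for x y I
    using that by (simp add: imag_units_iff of_real_quat quat_eq_iff matrix_vector_mult_scaleR)
  ultimately show ?thesis
    unfolding orthogonal_slice_map_def by auto
qed


section \<open>Riemannian metrics on open subsets of a Euclidean space\<close>

text \<open>\<open>U\<close> is meant to be open. In finite dimension, \<open>C\<^sup>k\<close> can be tested on directional derivatives.\<close>

primrec Ck_on :: "nat \<Rightarrow> 'a::euclidean_space set \<Rightarrow> ('a \<Rightarrow> 'b::real_normed_vector) \<Rightarrow> bool"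
  where
    "Ck_on 0 U f \<longleftrightarrow> continuous_on U f"
  | "Ck_on (Suc k) U f \<longleftrightarrow> (\<forall>x\<in>U. f differentiable (at x)) \<and>
      (\<forall>v. Ck_on k U (\<lambda>x. frechet_derivative f (at x) v))"

definition smooth_on :: "'a::euclidean_space set \<Rightarrow> ('a \<Rightarrow> 'b::real_normed_vector) \<Rightarrow> bool"
  where "smooth_on U f \<longleftrightarrow> (\<forall>k. Ck_on k U f)"

text \<open>\<open>m p v w\<close> is the inner product of the tangent vectors \<open>v\<close> and \<open>w\<close> at \<open>p\<close>; tangent spaces of
  an open subset are identified with the ambient space.\<close>

definition riemannian_metric_on ::
    "'a::euclidean_space set \<Rightarrow> ('a \<Rightarrow> 'a \<Rightarrow> 'a \<Rightarrow> real) \<Rightarrow> bool"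
  where "riemannian_metric_on U m \<longleftrightarrow>
    (\<forall>p\<in>U. bilinear (m p) \<and> (\<forall>v w. m p v w = m p w v) \<and> (\<forall>v. v \<noteq> 0 \<longrightarrow> m p v v > 0)) \<and>
    (\<forall>v w. smooth_on U (\<lambda>p. m p v w))"

definition diffeomorphism_on :: "'a::euclidean_space set \<Rightarrow> ('a \<Rightarrow> 'a) \<Rightarrow> bool"
  where "diffeomorphism_on U \<phi> \<longleftrightarrow>
    bij_betw \<phi> U U \<and> smooth_on U \<phi> \<and> smooth_on U (the_inv_into U \<phi>)"

definition riemannian_isometry_on ::
    "'a::euclidean_space set \<Rightarrow> ('a \<Rightarrow> 'a \<Rightarrow> 'a \<Rightarrow> real) \<Rightarrow> ('a \<Rightarrow> 'a) \<Rightarrow> bool"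
  where "riemannian_isometry_on U m \<phi> \<longleftrightarrow> diffeomorphism_on U \<phi> \<and>
    (\<forall>p\<in>U. \<forall>v w. m (\<phi> p) (frechet_derivative \<phi> (at p) v) (frechet_derivative \<phi> (at p) w) = m p v w)"

end

theory Submission
  imports Defs
begin

text \<open>There are two regular Moebius transformations that cannot both be isometries. Fix an
  imaginary \<open>a\<close> with \<open>0 < \<bar>a\<bar> < 1\<close> and an imaginary \<open>v\<close>
  orthogonal to \<open>a\<close>. The transformation with \<open>u = -1\<close> maps \<open>0\<close> to \<open>a\<close>, the one with
  \<open>u = 1\<close> maps \<open>a\<close> to \<open>0\<close>, and both differentials map \<open>v\<close> to a multiple of \<open>v\<close>:
  the first has factor \<open>-(1 - \<bar>a\<bar>\<^sup>2)\<close>, the second has factor \<open>1 / (1 + \<bar>a\<bar>\<^sup>2)\<close>. If both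
  are isometries, the length of \<open>v\<close> at \<open>a\<close> is its length at \<open>0\<close> divided by
  \<open>1 - \<bar>a\<bar>\<^sup>2\<close>, and also divided by \<open>1 + \<bar>a\<bar>\<^sup>2\<close>, which is absurd as \<open>v\<close> has positive
  length. (In a direction that commutes with \<open>a\<close> the second factor would be
  \<open>1 / (1 - \<bar>a\<bar>\<^sup>2)\<close>, and there is no conflict: on the complex slice through \<open>a\<close> both maps are
  classical Moebius transformations.)

  Both differentials come from a closed form of the transformation on imaginary quaternions
  (lemma \<open>regular_moebius_imaginary\<close>). There \<open>q\<^sup>2\<close> and \<open>a\<^sup>2\<close> are real, so the power series
  collapses to a geometric series with real ratio. Along the line \<open>p + t v\<close> with \<open>v\<close> orthogonal
  to \<open>p\<close> the norm is stationary at \<open>t = 0\<close>, and only the linear term of the closed form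
  contributes to the derivative.\<close>

lemma qcnj_mult_self: "qcnj a * a = of_real ((norm a)\<^sup>2)"
  by (simp add: qcnj_def of_real_quat quat_eq_iff norm_quat_def inner_quat_def power2_eq_square)

lemma norm_qcnj: "norm (qcnj a) = norm a"
  by (simp add: qcnj_def norm_quat_def inner_quat_def)

lemma imaginary_square:
  assumes "qRe q = 0"
  shows "q * q = - of_real ((norm q)\<^sup>2)"
  using assms
  by (simp add: of_real_quat quat_eq_iff norm_quat_def inner_quat_def)

text \<open>Both terms of the factor \<open>q - a\<close> contribute a real multiple of the same power of \<open>qcnj a\<close>,
  because \<open>qcnj a * a = \<bar>a\<bar>\<^sup>2\<close> is real.\<close>

lemma moebius_coefficients:
  "fps_nth (inverse (1 - fps_X * fps_const (qcnj a)) * (fps_X - fps_const a)) n =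
    (case n of 0 \<Rightarrow> - a | Suc k \<Rightarrow> (1 - (norm a)\<^sup>2) *\<^sub>R qcnj a ^ k)"
proof (cases n)
  case 0
  then show ?thesis
    by (simp add: star_inverse(3))
next
  case (Suc k)
  have "qcnj a ^ Suc k * a = qcnj a ^ k * (qcnj a * a)"
    by (simp only: power_Suc2 mult.assoc)
  also have "\<dots> = (norm a)\<^sup>2 *\<^sub>R qcnj a ^ k"
    by (simp add: qcnj_mult_self scaleR_conv_of_real flip: of_real_power)
       (metis mult_scaleR_right mult.right_neutral of_real_def scaleR_conv_of_real)
  finally show ?thesis
    using Suc by (simp add: star_inverse(3) right_diff_distrib scaleR_left_diff_distrib)
qed

lemma regular_moebius_sums:
  assumes "(\<lambda>n. q ^ n * qcnj a ^ n) sums T"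
  shows "regular_moebius a u q = (- a + (1 - (norm a)\<^sup>2) *\<^sub>R (q * T)) * u"
proof -
  let ?c = "fps_nth (inverse (1 - fps_X * fps_const (qcnj a)) * (fps_X - fps_const a))"
  have "(\<lambda>n. (1 - (norm a)\<^sup>2) *\<^sub>R (q * (q ^ n * qcnj a ^ n))) sums ((1 - (norm a)\<^sup>2) *\<^sub>R (q * T))"
    by (intro sums_scaleR_right sums_mult assms)
  then have "(\<lambda>n. q ^ Suc n * ?c (Suc n)) sums ((1 - (norm a)\<^sup>2) *\<^sub>R (q * T))"
    by (simp add: moebius_coefficients mult.assoc)
  then have "(\<lambda>n. q ^ n * ?c n) sums ((1 - (norm a)\<^sup>2) *\<^sub>R (q * T) + q ^ 0 * ?c 0)"
    by (rule sums_Suc)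
  then show ?thesis
    by (simp add: regular_moebius_def qeval_def sums_iff moebius_coefficients)
qed

text \<open>Since \<open>q\<^sup>2\<close> and \<open>a\<^sup>2\<close> are real, the terms of \<open>\<Sum> q\<^sup>n (qcnj a)\<^sup>n\<close> two steps apart differ by
  the real factor \<open>\<bar>q\<bar>\<^sup>2 \<bar>a\<bar>\<^sup>2\<close>, although \<open>q\<close> and \<open>a\<close> need not commute. So the sum \<open>T\<close>
  satisfies a linear equation with real coefficients.\<close>

lemma regular_moebius_imaginary:
  assumes a: "a \<in> unit_ball" "qRe a = 0" and q: "q \<in> unit_ball" "qRe q = 0"
  shows "regular_moebius a u q =
    (- a + ((1 - (norm a)\<^sup>2) / (1 - (norm q)\<^sup>2 * (norm a)\<^sup>2)) *\<^sub>R (q + (norm q)\<^sup>2 *\<^sub>R a)) * u"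
proof -
  define f where "f n = q ^ n * qcnj a ^ n" for n
  define l where "l = (norm q)\<^sup>2 * (norm a)\<^sup>2"
  have lt: "norm q * norm a < 1"
    using a q mult_strict_mono[of "norm q" 1 "norm a" 1] by (simp add: unit_ball_def)
  then have "(norm q * norm a)\<^sup>2 < 1"
    by (simp add: abs_square_less_1)
  then have l1: "1 - l \<noteq> 0"
    by (simp add: l_def power_mult_distrib)
  have "summable f"
    unfolding f_def
    by (rule summable_comparison_test[OF _ summable_geometric[of "norm q * norm a"]])
       (use lt in \<open>auto simp: norm_mult norm_power norm_qcnj power_mult_distrib\<close>)
  then obtain T where T: "f sums T"
    by (auto simp: summable_def)
  have cnj: "qcnj a = - a"
    using a by (simp add: qcnj_def quat_eq_iff)
  have sq: "q * q = (- (norm q)\<^sup>2) *\<^sub>R 1" "qcnj a * qcnj a = (- (norm a)\<^sup>2) *\<^sub>R 1"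
    using imaginary_square[OF a(2)] imaginary_square[OF q(2)] by (simp_all add: cnj of_real_def)
  have "f (n + 2) = q ^ n * (q * q) * (qcnj a * qcnj a) * qcnj a ^ n" for n
    unfolding f_def power_add power2_eq_square
    by (simp add: mult.assoc power_commutes flip: power_Suc2)
       (metis mult.assoc power_commutes)
  then have "f (n + 2) = l *\<^sub>R f n" for n
    by (simp add: f_def sq l_def)
  moreover have "(\<lambda>n. f (n + 2)) sums (T - (\<Sum>i<2. f i))"
    using T by (rule sums_split_initial_segment)
  ultimately have "(\<lambda>n. l *\<^sub>R f n) sums (T - (f 0 + f 1))"
    by (simp add: numeral_2_eq_2)
  moreover have "(\<lambda>n. l *\<^sub>R f n) sums (l *\<^sub>R T)"
    using T by (rule sums_scaleR_right)
  ultimately have "T - (f 0 + f 1) = l *\<^sub>R T"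
    by (rule sums_unique2)
  then have "(1 - l) *\<^sub>R T = 1 + q * qcnj a"
    by (simp add: f_def algebra_simps)
  then have "T = (1 / (1 - l)) *\<^sub>R (1 + q * qcnj a)"
    using l1 by (metis divide_inverse mult_1 scaleR_scaleR left_inverse scaleR_one)
  then have "q * T = (1 / (1 - l)) *\<^sub>R (q + q * q * qcnj a)"
    by (simp add: distrib_left mult.assoc)
  also have "q * q * qcnj a = (norm q)\<^sup>2 *\<^sub>R a"
    by (simp add: sq cnj)
  finally show ?thesis
    using regular_moebius_sums[OF T[unfolded f_def], of u] by (simp add: l_def)
qed

text \<open>Orthogonality of \<open>v\<close> to \<open>p\<close> makes \<open>\<bar>p + t v\<bar>\<^sup>2\<close> an even function of \<open>t\<close>, so every
  dependence on the norm in the closed form drops out at \<open>t = 0\<close>.\<close>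

lemma frechet_derivative_regular_moebius_imaginary:
  assumes a: "a \<in> unit_ball" "qRe a = 0" and p: "p \<in> unit_ball" "qRe p = 0"
    and v: "qRe v = 0" "inner p v = 0"
    and diff: "regular_moebius a u differentiable (at p)"
  shows "frechet_derivative (regular_moebius a u) (at p) v =
    ((1 - (norm a)\<^sup>2) / (1 - (norm p)\<^sup>2 * (norm a)\<^sup>2)) *\<^sub>R v * u"
proof -
  let ?F = "regular_moebius a u"
  define N where "N t = (norm p)\<^sup>2 + t\<^sup>2 * (norm v)\<^sup>2" for t
  define G where "G t = (- a + ((1 - (norm a)\<^sup>2) / (1 - N t * (norm a)\<^sup>2)) *\<^sub>R
    ((p + t *\<^sub>R v) + N t *\<^sub>R a)) * u" for t
  have N: "(norm (p + t *\<^sub>R v))\<^sup>2 = N t" for t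
    using v unfolding N_def power2_norm_eq_inner
    by (simp add: inner_add_left inner_add_right inner_commute[of v p] power2_eq_square)
  have F_eq_G: "?F (p + t *\<^sub>R v) = G t" if "norm (p + t *\<^sub>R v) < 1" for t
    using regular_moebius_imaginary[OF a, of "p + t *\<^sub>R v" u] that p v
    by (simp add: unit_ball_def G_def N)
  have "norm p * norm a < 1"
    using a p mult_strict_mono[of "norm p" 1 "norm a" 1] by (simp add: unit_ball_def)
  then have "(norm p * norm a)\<^sup>2 < 1"
    by (simp add: abs_square_less_1)
  then have nz: "1 - (norm p)\<^sup>2 * (norm a)\<^sup>2 \<noteq> 0"
    by (simp add: power_mult_distrib)
  have dN: "(N has_real_derivative 0) (at 0)"
    unfolding N_def by (auto intro!: derivative_eq_intros)
  have N0: "N 0 = (norm p)\<^sup>2"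
    by (simp add: N_def)
  have dc: "((\<lambda>t. (1 - (norm a)\<^sup>2) / (1 - N t * (norm a)\<^sup>2)) has_real_derivative 0) (at 0)"
    using nz by (auto intro!: derivative_eq_intros dN simp: N0)
  have "(G has_vector_derivative
      (((1 - (norm a)\<^sup>2) / (1 - (norm p)\<^sup>2 * (norm a)\<^sup>2)) *\<^sub>R v) * u) (at 0)"
    unfolding G_def
    by (rule derivative_eq_intros dN dc refl | simp add: N0)+
  then have "((\<lambda>t. ?F (p + t *\<^sub>R v)) has_vector_derivative
      (((1 - (norm a)\<^sup>2) / (1 - (norm p)\<^sup>2 * (norm a)\<^sup>2)) *\<^sub>R v) * u) (at 0)"
    by (rule has_vector_derivative_transform_within_open[where S = "{t. norm (p + t *\<^sub>R v) < 1}"])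
       (use p in \<open>auto simp: unit_ball_def F_eq_G intro!: open_Collect_less continuous_intros\<close>)
  moreover have "((\<lambda>t. ?F (p + t *\<^sub>R v)) has_vector_derivative
      frechet_derivative ?F (at p) v) (at 0)"
  proof -
    have "((\<lambda>t. p + t *\<^sub>R v) has_vector_derivative v) (at 0)"
      by (auto intro!: derivative_eq_intros)
    moreover have "(?F has_derivative frechet_derivative ?F (at p)) (at (p + 0 *\<^sub>R v))"
      using diff by (simp add: frechet_derivative_works)
    ultimately show ?thesis
      using vector_derivative_diff_chain_within[of "\<lambda>t. p + t *\<^sub>R v" v 0 UNIV ?F]
      by (auto simp: o_def has_derivative_at_withinI)
  qed
  ultimately show ?thesis
    by (blast intro: vector_derivative_unique_at)
qed

lemma riemannian_isometry_on_differentiable: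
  assumes "riemannian_isometry_on U m \<phi>" "p \<in> U"
  shows "\<phi> differentiable (at p)"
proof -
  have "Ck_on (Suc 0) U \<phi>"
    using assms unfolding riemannian_isometry_on_def diffeomorphism_on_def smooth_on_def by blast
  then show ?thesis
    using assms(2) by simp
qed

theorem theorem1p2:
  shows "\<not> (\<exists>m. riemannian_metric_on unit_ball m \<and>
    (\<forall>a\<in>unit_ball. \<forall>u. norm u = 1 \<longrightarrow>
      riemannian_isometry_on unit_ball m (regular_moebius a u)) \<and>
    (\<forall>A \<phi>. orthogonal_slice_map A \<phi> \<longrightarrow> riemannian_isometry_on unit_ball m \<phi>))"
proof
  assume "\<exists>m. riemannian_metric_on unit_ball m \<and>
    (\<forall>a\<in>unit_ball. \<forall>u. norm u = 1 \<longrightarrow>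
      riemannian_isometry_on unit_ball m (regular_moebius a u)) \<and>
    (\<forall>A \<phi>. orthogonal_slice_map A \<phi> \<longrightarrow> riemannian_isometry_on unit_ball m \<phi>)"
  then obtain m where metric: "riemannian_metric_on unit_ball m"
    and iso: "\<And>a u. a \<in> unit_ball \<Longrightarrow> norm u = 1 \<Longrightarrow>
      riemannian_isometry_on unit_ball m (regular_moebius a u)"
    by blast
  define a where "a = Quat 0 (axis 1 (1/2))"
  define v where "v = Quat 0 (axis 2 1)"
  have norm_a: "(norm a)\<^sup>2 = 1/4"
    by (simp add: a_def norm_quat_def inner_quat_def inner_axis_axis)
  have "norm a < 1"
    by (rule power_less_imp_less_base[of _ 2]) (simp_all add: norm_a)
  then have a: "a \<in> unit_ball" "qRe a = 0"
    by (simp_all add: unit_ball_def a_def)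
  have z: "0 \<in> unit_ball" "qRe 0 = 0"
    by (simp_all add: unit_ball_def)
  have v: "qRe v = 0" "inner a v = 0" "inner 0 v = 0" "v \<noteq> 0"
    by (simp_all add: a_def v_def inner_quat_def inner_axis_axis quat_eq_iff axis_eq_0_iff)
  have bil: "bilinear (m p)" if "p \<in> unit_ball" for p
    using metric that by (simp add: riemannian_metric_on_def)
  have scale: "m p (c *\<^sub>R v) (c *\<^sub>R v) = c\<^sup>2 * m p v v" if "p \<in> unit_ball" for p c
    using bil[OF that] by (simp add: bilinear_lmul bilinear_rmul power2_eq_square)
  have push: "m (regular_moebius a u p) (frechet_derivative (regular_moebius a u) (at p) v)
      (frechet_derivative (regular_moebius a u) (at p) v) = m p v v"
    if "norm u = 1" "p \<in> unit_ball" for u p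
    using iso[OF a(1) that(1)] that(2) by (simp add: riemannian_isometry_on_def)
  have deriv: "frechet_derivative (regular_moebius a u) (at p) v =
      ((1 - (norm a)\<^sup>2) / (1 - (norm p)\<^sup>2 * (norm a)\<^sup>2)) *\<^sub>R v * u"
    if "norm u = 1" "p \<in> unit_ball" "qRe p = 0" "inner p v = 0" for u p
    using that riemannian_isometry_on_differentiable[OF iso[OF a(1) that(1)] that(2)]
    by (intro frechet_derivative_regular_moebius_imaginary a v)

  \<comment> \<open>The factor \<open>1 / (1 + \<bar>a\<bar>\<^sup>2)\<close>, from \<open>a\<close> to \<open>0\<close>; here \<open>\<bar>a\<bar>\<^sup>2 = 1/4\<close>.\<close>
  have "regular_moebius a 1 a = - a + (4/5) *\<^sub>R (a + (1/4) *\<^sub>R a)"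
    using regular_moebius_imaginary[OF a a, of 1] by (simp add: norm_a)
  also have "\<dots> = 0"
    by (simp add: scaleR_add_right flip: scaleR_add_left)
  finally have at_a: "m a v v = (4/5)\<^sup>2 * m 0 v v"
    using push[of 1 a] deriv[of 1 a] a v scale[OF z(1), of "4/5"] by (simp add: norm_a)

  \<comment> \<open>The factor \<open>-(1 - \<bar>a\<bar>\<^sup>2)\<close>, from \<open>0\<close> to \<open>a\<close>.\<close>
  have "regular_moebius a (-1) 0 = a"
    using regular_moebius_imaginary[OF a z, of "-1"] by simp
  then have at_0: "m 0 v v = (3/4)\<^sup>2 * m a v v"
    using push[of "-1" 0] deriv[of "-1" 0] z v scale[OF a(1), of "-(3/4)"] by (simp add: norm_a)

  have "m 0 v v > 0"
    using metric z v by (simp add: riemannian_metric_on_def)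
  with at_a at_0 show False
    by (simp add: power2_eq_square)
qed

end
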